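(* Let $\mathcal{DB}_i=(\mathcal{D}_i,\mathcal{IC}_i)$, $i=1,\dots,n$, be consistent databases, let $\mathcal{D}=\bigcup_{i=1}^n\mathcal{D}_i$ and $\mathcal{IC}=\bigcup_{i=1}^n\mathcal{IC}_i$, with $\mathcal{IC}$ classically consistent, let $\mathcal{UDB}=(\mathcal{D},\mathcal{IC})$, and let $\mathcal{T}$ be the abductive theory encoding the integration of $\mathcal{DB}_1,\dots,\mathcal{DB}_n$. Suppose that the query `$\leftarrow \mathtt{true}$' has a finite SLDNFA refutation tree with respect to $\mathcal{T}$. Then: (1) for every output $(\mathrm{Insert},\mathrm{Retract})$ of the $\mathcal{A}$-system for $\mathcal{T}$ there is a classical (two-valued) model $M$ of $\mathcal{IC}$ such that $\mathrm{Insert}=M^{t}\setminus\mathcal{D}$ and $\mathrm{Retract}=\mathcal{D}\setminus M^{t}$; (2) for every two-valued model $M$ of $\mathcal{IC}$ there is an output $(\mathrm{Insert},\mathrm{Retract})$ of the $\mathcal{A}$-system for $\mathcal{T}$ such that $\mathrm{Insert}=M^{t}\setminus\mathcal{D}$ and $\mathrm{Retract}=\mathcal{D}\setminus M^{t}$.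
   Context: Setting. Fix a first-order language $L$ over a fixed database schema (relation names) and a fixed domain $U$; every element of $U$ has a unique name, there are no other function symbols, quantifiers range over $U$, and equality is identity on $U$. "Atom" means ground atom $P(t)$, with $P$ a relation name and $t$ a tuple over $U$. A database instance $\mathcal{D}$ is a set of atoms with finite active domain. A database is a pair $(\mathcal{D},\mathcal{IC})$ with $\mathcal{D}$ an instance and $\mathcal{IC}$ (integrity constraints) a finite set of first-order formulas of $L$ (free variables, if any, read as universally quantified). The unified database $\mathcal{UDB}$ need not be consistent. Two-valued semantics. A two-valued valuation assigns $t$ or $f$ to each atom and extends classically to all formulas; a classical (two-valued) model of $\mathcal{IC}$ is such a valuation making all formulas of $\mathcal{IC}$ true. $\mathcal{IC}$ is classically consistent if it has a classical model. $M^{t}$ is the set of atoms $p$ with $M(p)=t$. For a set $S$ of atoms, $\mathcal{H}^{S}$ assigns $t$ to the atoms in $S$ and $f$ to all other atoms; $S\models\mathcal{IC}$ means $\mathcal{H}^{S}$ is a model of $\mathcal{IC}$. $(S,\mathcal{IC})$ is consistent if $\mathcal{IC}$ is classically consistent and $S\models\mathcal{IC}$. Repairs. A repair of $(\mathcal{D},\mathcal{IC})$ is a pair $(\mathrm{Insert},\mathrm{Retract})$ of sets of atoms such that (1) $\mathrm{Insert}\cap\mathcal{D}=\emptyset$, (2) $\mathrm{Retract}\subseteq\mathcal{D}$, (3) $((\mathcal{D}\cup\mathrm{Insert})\setminus\mathrm{Retract},\mathcal{IC})$ is consistent. The abductive theory $\mathcal{T}$. It has defined predicates $\mathtt{db},\mathtt{fact}$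 and open (abducible) predicates $\mathtt{insert},\mathtt{retract}$, ranging over atoms of $L$; facts $\mathtt{db}(p)$ for each $p\in\mathcal{D}$; rules $\mathtt{fact}(X)\leftarrow \mathtt{db}(X),\ \mathtt{not}\ \mathtt{retract}(X)$ and $\mathtt{fact}(X)\leftarrow\mathtt{insert}(X)$; constraints $\mathtt{false}\leftarrow\mathtt{retract}(X),\ \mathtt{not}\ \mathtt{db}(X)$ and $\mathtt{false}\leftarrow\mathtt{insert}(X),\ \mathtt{db}(X)$; and all formulas of $\mathcal{IC}$ with every database atom $R(x)$ replaced by $\mathtt{fact}(R(x))$. The solver. The $\mathcal{A}$-system is an abductive solver implementing SLDNFA-resolution (a refutation procedure for abductive logic programs). Run on $\mathcal{T}$ with query `$\leftarrow\mathtt{true}$', it outputs abductive solutions, each a pair $(\mathrm{Insert},\mathrm{Retract})$ of finite lists of atoms abduced for $\mathtt{insert}$ and $\mathtt{retract}$. The hypothesis that the query has a finite SLDNFA refutation tree means that the search tree of this procedure on $\mathcal{T}$ is finite. The solver enters through the following previously established specification, to be taken as given: (a) every output of the $\mathcal{A}$-system for $\mathcal{T}$ is a repair of $\mathcal{UDB}$; (b) if the query `$\leftarrow\mathtt{true}$' has a finite SLDNFA tree with respect to $\mathcal{T}$, then every repair of $\mathcal{UDB}$ is an output of the $\mathcal{A}$-system for $\mathcal{T}$. *)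

theory Defs
  imports Main
begin

section \<open>First-order language over a database schema\<close>

text \<open>The domain is the whole type \<open>'u\<close>, and each of its elements is its own name. Relation names
  are the elements of \<open>'r\<close>; the schema \<open>ar\<close> below gives their arities.\<close>

datatype 'u tm = Var nat | Name 'u

text \<open>Ground atoms have type \<open>('r, 'u) atom\<close>, atomic formulas \<open>('r, 'u tm) atom\<close>.\<close>

datatype ('r, 'a) atom = Atom (rel: 'r) (args: "'a list")

text \<open>Formulas are parametric in the atomic formulas \<open>'p\<close>, so that the same syntax serves both
  the database language and the language of the abductive theory.\<close>

datatype (atoms_of: 'p, names_of: 'u) fm =
    Top
  | Atm 'p
  | Eq "'u tm" "'u tm"
  | Neg "('p, 'u) fm"
  | And "('p, 'u) fm" "('p, 'u) fm"
  | Or "('p, 'u) fm" "('p, 'u) fm"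
  | Imp "('p, 'u) fm" "('p, 'u) fm"
  | Iff "('p, 'u) fm" "('p, 'u) fm"
  | All nat "('p, 'u) fm"
  | Ex nat "('p, 'u) fm"
  for map: map_fm

type_synonym ('r, 'u) formula = "(('r, 'u tm) atom, 'u) fm"

definition wf_atom :: "('r \<Rightarrow> nat) \<Rightarrow> ('r, 'a) atom \<Rightarrow> bool" where
  "wf_atom ar p \<longleftrightarrow> length (args p) = ar (rel p)"

definition ground_atoms :: "('r \<Rightarrow> nat) \<Rightarrow> ('r, 'u) atom set" where
  "ground_atoms ar = {p. wf_atom ar p}"

definition wf_formula :: "('r \<Rightarrow> nat) \<Rightarrow> ('r, 'u) formula \<Rightarrow> bool" where
  "wf_formula ar \<phi> \<longleftrightarrow> (\<forall>p \<in> atoms_of \<phi>. wf_atom ar p)"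

section \<open>Two-valued semantics\<close>

text \<open>Valuations are total on the type of ground atoms; their values outside \<open>ground_atoms ar\<close>
  are never consulted by well-formed formulas and are discarded by \<open>true_atoms\<close>.\<close>

type_synonym ('r, 'u) valuation = "('r, 'u) atom \<Rightarrow> bool"

primrec tm_val :: "(nat \<Rightarrow> 'u) \<Rightarrow> 'u tm \<Rightarrow> 'u" where
  "tm_val e (Var x) = e x"
| "tm_val e (Name a) = a"

primrec holds :: "('r, 'u) valuation \<Rightarrow> (nat \<Rightarrow> 'u) \<Rightarrow> ('r, 'u) formula \<Rightarrow> bool" where
  "holds M e Top \<longleftrightarrow> True"
| "holds M e (Atm p) \<longleftrightarrow> M (map_atom id (tm_val e) p)"
| "holds M e (Eq s t) \<longleftrightarrow> tm_val e s = tm_val e t"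
| "holds M e (Neg \<phi>) \<longleftrightarrow> \<not> holds M e \<phi>"
| "holds M e (And \<phi> \<psi>) \<longleftrightarrow> holds M e \<phi> \<and> holds M e \<psi>"
| "holds M e (Or \<phi> \<psi>) \<longleftrightarrow> holds M e \<phi> \<or> holds M e \<psi>"
| "holds M e (Imp \<phi> \<psi>) \<longleftrightarrow> (holds M e \<phi> \<longrightarrow> holds M e \<psi>)"
| "holds M e (Iff \<phi> \<psi>) \<longleftrightarrow> (holds M e \<phi> \<longleftrightarrow> holds M e \<psi>)"
| "holds M e (All x \<phi>) \<longleftrightarrow> (\<forall>a. holds M (e(x := a)) \<phi>)"
| "holds M e (Ex x \<phi>) \<longleftrightarrow> (\<exists>a. holds M (e(x := a)) \<phi>)"

definition classical_model :: "('r, 'u) valuation \<Rightarrow> ('r, 'u) formula set \<Rightarrow> bool" where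
  "classical_model M IC \<longleftrightarrow> (\<forall>\<phi> \<in> IC. \<forall>e. holds M e \<phi>)"

definition classically_consistent :: "('r, 'u) formula set \<Rightarrow> bool" where
  "classically_consistent IC \<longleftrightarrow> (\<exists>M. classical_model M IC)"

definition true_atoms :: "('r \<Rightarrow> nat) \<Rightarrow> ('r, 'u) valuation \<Rightarrow> ('r, 'u) atom set" where
  "true_atoms ar M = {p \<in> ground_atoms ar. M p}"

definition herbrand :: "('r, 'u) atom set \<Rightarrow> ('r, 'u) valuation" where
  "herbrand S = (\<lambda>p. p \<in> S)"

section \<open>Databases and repairs\<close>

type_synonym ('r, 'u) database = "('r, 'u) atom set \<times> ('r, 'u) formula set"

definition active_domain :: "('r, 'u) atom set \<Rightarrow> 'u set" where
  "active_domain D = (\<Union>p \<in> D. set (args p))"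

definition is_database :: "('r \<Rightarrow> nat) \<Rightarrow> ('r, 'u) database \<Rightarrow> bool" where
  "is_database ar = (\<lambda>(D, IC).
     D \<subseteq> ground_atoms ar \<and> finite (active_domain D) \<and>
     finite IC \<and> (\<forall>\<phi> \<in> IC. wf_formula ar \<phi>))"

definition consistent :: "('r, 'u) database \<Rightarrow> bool" where
  "consistent = (\<lambda>(S, IC). classically_consistent IC \<and> classical_model (herbrand S) IC)"

definition is_repair ::
  "('r \<Rightarrow> nat) \<Rightarrow> ('r, 'u) database \<Rightarrow> ('r, 'u) atom set \<times> ('r, 'u) atom set \<Rightarrow> bool" where
  "is_repair ar = (\<lambda>(D, IC) (Ins, Ret).
     Ins \<subseteq> ground_atoms ar \<and> Ins \<inter> D = {} \<and> Ret \<subseteq> D \<and>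
     consistent ((D \<union> Ins) - Ret, IC))"

definition unified_database :: "nat \<Rightarrow> (nat \<Rightarrow> ('r, 'u) database) \<Rightarrow> ('r, 'u) database" where
  "unified_database n DB = (\<Union>i \<in> {1..n}. fst (DB i), \<Union>i \<in> {1..n}. snd (DB i))"

section \<open>The abductive theory\<close>

datatype pred = Db | Fact | Insert | Retract

text \<open>The argument of a predicate denotes an atom of the database language: either a variable \<open>X\<close>
  ranging over such atoms, or \<open>R(x)\<close> with ordinary terms as arguments. Atom variables and domain
  variables are of different sorts.\<close>

datatype ('r, 'u) atom_tm = AVar nat | ATm "('r, 'u tm) atom"

type_synonym ('r, 'u) abd_atom = "pred \<times> ('r, 'u) atom_tm"

type_synonym ('r, 'u) abd_formula = "(('r, 'u) abd_atom, 'u) fm"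

text \<open>A pair \<open>(h, b)\<close> in \<open>rules\<close> is the clause with head \<open>h\<close> and body \<open>b\<close>, a fact if \<open>b = Top\<close>;
  a member \<open>b\<close> of \<open>denials\<close> is the constraint with head \<open>false\<close> and body \<open>b\<close>; members of
  \<open>assertions\<close> are first-order integrity constraints.\<close>

record ('r, 'u) abductive_theory =
  defined :: "pred set"
  abducible :: "pred set"
  rules :: "(('r, 'u) abd_atom \<times> ('r, 'u) abd_formula) set"
  denials :: "('r, 'u) abd_formula set"
  assertions :: "('r, 'u) abd_formula set"

definition integration_theory :: "('r, 'u) database \<Rightarrow> ('r, 'u) abductive_theory" where
  "integration_theory = (\<lambda>(D, IC). let X = AVar 0 in
     \<lparr> defined = {Db, Fact},
       abducible = {Insert, Retract},
       rules =
         (\<lambda>p. ((Db, ATm (map_atom id Name p)), Top)) ` D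
         \<union> {((Fact, X), And (Atm (Db, X)) (Neg (Atm (Retract, X)))),
            ((Fact, X), Atm (Insert, X))},
       denials =
         {And (Atm (Retract, X)) (Neg (Atm (Db, X))),
          And (Atm (Insert, X)) (Atm (Db, X))},
       assertions = map_fm (\<lambda>p. (Fact, ATm p)) id ` IC \<rparr>)"

section \<open>The abductive solver\<close>

text \<open>The solver is kept abstract. For a theory and a query body, \<open>search_tree\<close> is the set of nodes
  of its SLDNFA search tree, a node being identified with the list of choices leading to it from
  the root; branching and depth may be infinite. Answers are the pairs of lists of atoms abduced
  for \<open>insert\<close> and \<open>retract\<close>.\<close>

record ('r, 'u, 'c) solver =
  search_tree :: "('r, 'u) abductive_theory \<Rightarrow> ('r, 'u) abd_formula \<Rightarrow> 'c list set"
  answers :: "('r, 'u) abductive_theory \<Rightarrow> ('r, 'u) abd_formula \<Rightarrow>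
    (('r, 'u) atom list \<times> ('r, 'u) atom list) set"

definition is_tree :: "'c list set \<Rightarrow> bool" where
  "is_tree N \<longleftrightarrow> [] \<in> N \<and> (\<forall>xs x. xs @ [x] \<in> N \<longrightarrow> xs \<in> N)"

definition has_finite_tree ::
  "('r, 'u, 'c) solver \<Rightarrow> ('r, 'u) abductive_theory \<Rightarrow> ('r, 'u) abd_formula \<Rightarrow> bool" where
  "has_finite_tree A T q \<longleftrightarrow> is_tree (search_tree A T q) \<and> finite (search_tree A T q)"

text \<open>The query with body \<open>true\<close> is \<open>Top\<close>. Outputs are compared with repairs as pairs of sets.\<close>

definition outputs ::
  "('r, 'u, 'c) solver \<Rightarrow> ('r, 'u) abductive_theory \<Rightarrow>
    (('r, 'u) atom set \<times> ('r, 'u) atom set) set" where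
  "outputs A T = (\<lambda>(ins, ret). (set ins, set ret)) ` answers A T Top"

end

theory Submission
  imports Defs
begin

text \<open>Repairs of \<open>(D, IC)\<close> and models of \<open>IC\<close> are two descriptions of the same thing: a repair
  amounts to the set of atoms \<open>(D \<union> Ins) - Ret\<close>, and a set \<open>S\<close> of atoms is reached from \<open>D\<close> by exactly
  one repair, \<open>(S - D, D - S)\<close>. The specification of the solver identifies its outputs with the
  repairs.\<close>

lemma wf_atom_map_atom [simp]: "wf_atom ar (map_atom id f p) \<longleftrightarrow> wf_atom ar p"
  by (cases p) (simp add: wf_atom_def)

text \<open>Evaluating the terms of an atomic formula keeps its relation name and the number of its
  arguments, so a well-formed formula consults a valuation only at ground atoms. The induction needs
  \<open>e\<close> arbitrary because quantifiers update it.\<close>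

lemma holds_cong_ground_atoms:
  assumes "wf_formula ar \<phi>" and "\<And>p. p \<in> ground_atoms ar \<Longrightarrow> M p = N p"
  shows "holds M e \<phi> \<longleftrightarrow> holds N e \<phi>"
  using assms(1)
  by (induction \<phi> arbitrary: e) (auto simp: wf_formula_def ground_atoms_def assms(2))

text \<open>Passing from \<open>M\<close> to its set of true atoms changes values only at ill-formed
  atoms. This lets any model of \<open>IC\<close> be treated as a set of ground atoms.\<close>

lemma classical_model_herbrand_true_atoms:
  assumes "\<And>\<phi>. \<phi> \<in> IC \<Longrightarrow> wf_formula ar \<phi>"
  shows "classical_model (herbrand (true_atoms ar M)) IC \<longleftrightarrow> classical_model M IC"
proof -
  have "holds (herbrand (true_atoms ar M)) e \<phi> \<longleftrightarrow> holds M e \<phi>" if "\<phi> \<in> IC" for \<phi> e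
    using assms[OF that] by (rule holds_cong_ground_atoms) (simp add: herbrand_def true_atoms_def)
  then show ?thesis
    by (simp add: classical_model_def)
qed

lemma true_atoms_herbrand: "S \<subseteq> ground_atoms ar \<Longrightarrow> true_atoms ar (herbrand S) = S"
  by (auto simp: true_atoms_def herbrand_def)

lemma is_repair_iff_model:
  assumes D: "D \<subseteq> ground_atoms ar" and IC: "\<And>\<phi>. \<phi> \<in> IC \<Longrightarrow> wf_formula ar \<phi>"
  shows "is_repair ar (D, IC) (Ins, Ret) \<longleftrightarrow>
    (\<exists>M. classical_model M IC \<and> Ins = true_atoms ar M - D \<and> Ret = D - true_atoms ar M)"
proof
  assume rep: "is_repair ar (D, IC) (Ins, Ret)"
  \<comment> \<open>The repaired instance; \<open>herbrand S\<close> will be the required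
    model.\<close>
  define S where "S = (D \<union> Ins) - Ret"
  have "true_atoms ar (herbrand S) = S"
    by (rule true_atoms_herbrand) (use D rep in \<open>auto simp: S_def is_repair_def\<close>)
  \<comment> \<open>\<open>Ins\<close> and \<open>Ret\<close> can be read off from \<open>S\<close>:
    since \<open>Ins\<close> is disjoint from \<open>D\<close> and \<open>Ret\<close> lies inside
    \<open>D\<close>, no inserted atom is retracted again.\<close>
  moreover have "classical_model (herbrand S) IC" "Ins = S - D" "Ret = D - S"
    using rep by (auto simp: is_repair_def consistent_def S_def)
  ultimately show "\<exists>M. classical_model M IC \<and> Ins = true_atoms ar M - D \<and> Ret = D - true_atoms ar M"
    by metis
next
  assume "\<exists>M. classical_model M IC \<and> Ins = true_atoms ar M - D \<and> Ret = D - true_atoms ar M"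
  then obtain M where M: "classical_model M IC"
    and Ins: "Ins = true_atoms ar M - D" and Ret: "Ret = D - true_atoms ar M"
    by blast
  have "(D \<union> Ins) - Ret = true_atoms ar M"
    by (auto simp: Ins Ret)
  moreover have "classical_model (herbrand (true_atoms ar M)) IC"
    using M by (simp add: classical_model_herbrand_true_atoms IC)
  \<comment> \<open>\<open>M\<close> also witnesses the classical consistency that
    \<open>consistent\<close> demands, and the inserted atoms are ground because
    \<open>true_atoms\<close> keeps only ground ones.\<close>
  ultimately show "is_repair ar (D, IC) (Ins, Ret)"
    using M by (auto simp: is_repair_def consistent_def classically_consistent_def
        true_atoms_def Ins Ret)
qed

lemma unified_database_well_formed:
  assumes "\<And>i. i \<in> {1..n} \<Longrightarrow> is_database ar (DB i)"
    and "(D, IC) = unified_database n DB"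
  shows "D \<subseteq> ground_atoms ar" and "\<And>\<phi>. \<phi> \<in> IC \<Longrightarrow> wf_formula ar \<phi>"
proof -
  have eq: "D = (\<Union>i\<in>{1..n}. fst (DB i))" "IC = (\<Union>i\<in>{1..n}. snd (DB i))"
    using assms(2) by (simp_all add: unified_database_def)
  have "fst (DB i) \<subseteq> ground_atoms ar \<and> (\<forall>\<phi>\<in>snd (DB i). wf_formula ar \<phi>)" if "i \<in> {1..n}" for i
    using assms(1)[OF that] by (simp add: is_database_def case_prod_unfold)
  then show "D \<subseteq> ground_atoms ar" and "\<And>\<phi>. \<phi> \<in> IC \<Longrightarrow> wf_formula ar \<phi>"
    unfolding eq by blast+
qed

theorem corollary1:
  fixes ar :: "'r \<Rightarrow> nat"
    and n :: nat
    and DB :: "nat \<Rightarrow> ('r, 'u) database"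
    and D :: "('r, 'u) atom set"
    and IC :: "('r, 'u) formula set"
    and T :: "('r, 'u) abductive_theory"
    and A :: "('r, 'u, 'c) solver"
  assumes databases: "\<And>i. i \<in> {1..n} \<Longrightarrow> is_database ar (DB i) \<and> consistent (DB i)"
    and UDB: "(D, IC) = unified_database n DB"
    and IC_consistent: "classically_consistent IC"
    and T: "T = integration_theory (D, IC)"
    and solver_sound: "\<And>r. r \<in> outputs A T \<Longrightarrow> is_repair ar (D, IC) r"
    and solver_complete:
      "\<And>r. has_finite_tree A T Top \<Longrightarrow> is_repair ar (D, IC) r \<Longrightarrow> r \<in> outputs A T"
    and finite_tree: "has_finite_tree A T Top"
  shows "(\<forall>(Ins, Ret) \<in> outputs A T. \<exists>M. classical_model M IC \<and>
            Ins = true_atoms ar M - D \<and> Ret = D - true_atoms ar M) \<and>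
         (\<forall>M. classical_model M IC \<longrightarrow>
            (\<exists>(Ins, Ret) \<in> outputs A T.
               Ins = true_atoms ar M - D \<and> Ret = D - true_atoms ar M))"
proof -
  have ground: "D \<subseteq> ground_atoms ar" and wf: "\<And>\<phi>. \<phi> \<in> IC \<Longrightarrow> wf_formula ar \<phi>"
    using unified_database_well_formed[OF _ UDB] databases by blast+
  \<comment> \<open>The finite tree is what makes completeness available; soundness gives the other
    direction.\<close>
  have "(Ins, Ret) \<in> outputs A T \<longleftrightarrow> is_repair ar (D, IC) (Ins, Ret)" for Ins Ret
    using solver_sound solver_complete[OF finite_tree] by (rule iffI)
  then have outputs_iff: "(Ins, Ret) \<in> outputs A T \<longleftrightarrow>
      (\<exists>M. classical_model M IC \<and> Ins = true_atoms ar M - D \<and> Ret = D - true_atoms ar M)" for Ins Ret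
    using is_repair_iff_model[OF ground wf] by simp
  show ?thesis
  proof (intro conjI ballI allI impI)
    fix r assume "r \<in> outputs A T"
    then show "case r of (Ins, Ret) \<Rightarrow> \<exists>M. classical_model M IC \<and>
        Ins = true_atoms ar M - D \<and> Ret = D - true_atoms ar M"
      by (cases r) (simp only: outputs_iff prod.case)
  next
    fix M assume "classical_model M IC"
    \<comment> \<open>\<open>M\<close> itself is the witness on the right-hand side of
      \<open>outputs_iff\<close>.\<close>
    then have "(true_atoms ar M - D, D - true_atoms ar M) \<in> outputs A T"
      unfolding outputs_iff by blast
    then show "\<exists>(Ins, Ret) \<in> outputs A T. Ins = true_atoms ar M - D \<and> Ret = D - true_atoms ar M"
      by (rule bexI[rotated]) simp
  qed
qed

end
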